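(* Let $a,b\in\mathbb{N}$ and let $I$ be a nonempty subset of $\{0,1,\dots,b-2\}$. Write, for complex $|x|<1$, \[ \prod_{n=1}^{\infty}(1-x^n)^{-a}\prod_{i\in I} (1-x^{bn-i})^{a} = \sum_{n=0}^{\infty} A(n) x^n . \] Then $A(n)>0$ for all $n\in\mathbb{N}_0$.
   Context: $\mathbb{N}=\{1,2,3,\dots\}$, $\mathbb{N}_0=\{0,1,2,\dots\}$. For example, with $b=3$ this covers $\prod_{n\ge1}(1-x^n)^{-a}(1-x^{3n})^a$, $\prod_{n\ge1}(1-x^n)^{-a}(1-x^{3n-1})^a$ and $\prod_{n\ge1}(1-x^n)^{-a}(1-x^{3n})^a(1-x^{3n-1})^a$. *)

theory Defs
  imports "HOL-Analysis.Analysis"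
begin

end

theory Submission
  imports Defs "HOL-Complex_Analysis.Cauchy_Integral_Formula"
begin

text \<open>Since \<open>b - 1\<close> is not in \<open>I\<close>, the factor \<open>1 - x\<close> is never cancelled, so the product is
  the limit of the finite products \<open>Q\<^sub>N\<close> of \<open>(1 - x^m)^(-a)\<close> over the \<open>m \<le> b N\<close> that survive, among
  them \<open>m = 1\<close>. All factors have nonnegative coefficients and constant term 1, so the coefficients
  of \<open>Q\<^sub>N\<close> increase with \<open>N\<close> and are at least those of \<open>1 / (1 - x)\<close>. By monotone convergence
  their limits are the coefficients of the infinite product on \<open>(0, 1)\<close>, and these determine
  the coefficients \<open>A(n)\<close>.\<close>

section \<open>Power series\<close>

text \<open>A nonzero power series that vanishes at 0 has no further zeros near 0, whereas the
  hypothesis puts zeros of the difference at all small positive reals. Agreement is asked for on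
  positive reals only, since monotone convergence yields no more.\<close>

lemma powser_coeffs_unique_pos_real:
  fixes c d :: "nat \<Rightarrow> complex"
  assumes "r > 0"
    and c: "\<And>z. norm z < r \<Longrightarrow> summable (\<lambda>n. c n * z ^ n)"
    and d: "\<And>z. norm z < r \<Longrightarrow> summable (\<lambda>n. d n * z ^ n)"
    and eq: "\<And>x. 0 < x \<Longrightarrow> x < r \<Longrightarrow>
      (\<Sum>n. c n * of_real x ^ n) = (\<Sum>n. d n * of_real x ^ n)"
  shows "c = d"
proof (rule ccontr)
  assume "c \<noteq> d"
  then obtain m where m: "c m - d m \<noteq> 0" by auto
  \<comment> \<open>Shifting the coefficients by one makes the difference vanish at 0, as \<open>powser_0_nonzero\<close> requires.\<close>
  define e where "e n = (if n = 0 then 0 else c (n - 1) - d (n - 1))" for n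
  define f where "f z = z * ((\<Sum>n. c n * z ^ n) - (\<Sum>n. d n * z ^ n))" for z
  have sums: "(\<lambda>n. e n * (z - 0) ^ n) sums f z" if "norm (z - 0) < r" for z
  proof -
    have "(\<lambda>n. z * (c n * z ^ n - d n * z ^ n)) sums f z"
      unfolding f_def using c[of z] d[of z] that
      by (intro sums_mult sums_diff summable_sums) auto
    hence "(\<lambda>n. e (Suc n) * z ^ Suc n) sums f z"
      by (simp add: e_def algebra_simps)
    hence "(\<lambda>n. e n * z ^ n) sums (f z + e 0 * z ^ 0)"
      by (rule sums_Suc)
    thus ?thesis by (simp add: e_def)
  qed
  have "f 0 = 0" "e (Suc m) \<noteq> 0" using m by (auto simp: f_def e_def)
  then obtain s where "s > 0" and s: "\<And>z. z \<in> cball 0 s - {0} \<Longrightarrow> f z \<noteq> 0"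
    using powser_0_nonzero[OF \<open>r > 0\<close> sums, of "Suc m"] by blast
  define x where "x = min s (r / 2)"
  have "0 < x" "x < r" "x \<le> s" using \<open>s > 0\<close> \<open>r > 0\<close> by (auto simp: x_def)
  hence "f (of_real x) \<noteq> 0" by (intro s) auto
  moreover have "f (of_real x) = 0"
    using eq[OF \<open>0 < x\<close> \<open>x < r\<close>] by (simp add: f_def)
  ultimately show False by contradiction
qed

text \<open>Both inequalities between the limit series and \<open>P\<close> come from nonnegativity:
  its finite partial sums are limits of partial sums bounded by \<open>s N\<close>, and termwise
  domination by \<open>q\<close> bounds each \<open>s N\<close> by the full series.\<close>

lemma monotone_convergence_powser:
  fixes c :: "nat \<Rightarrow> nat \<Rightarrow> real"
  assumes nonneg: "\<And>N k. 0 \<le> c N k" and "x \<ge> 0"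
    and mono: "\<And>k. incseq (\<lambda>N. c N k)" and lim: "\<And>k. (\<lambda>N. c N k) \<longlonglongrightarrow> q k"
    and sums: "\<And>N. (\<lambda>k. c N k * x ^ k) sums s N" and s: "s \<longlonglongrightarrow> P"
  shows "(\<lambda>k. q k * x ^ k) sums P"
proof -
  have le: "c N k \<le> q k" for N k by (rule incseq_le[OF mono lim])
  have q: "0 \<le> q k * x ^ k" for k
    using order.trans[OF nonneg le, of k] \<open>x \<ge> 0\<close> by simp
  have bound: "(\<Sum>k<K. q k * x ^ k) \<le> P" for K
  proof (rule LIMSEQ_le[OF _ s])
    show "(\<lambda>N. \<Sum>k<K. c N k * x ^ k) \<longlonglongrightarrow> (\<Sum>k<K. q k * x ^ k)"
      by (intro tendsto_intros lim)
    have "(\<Sum>k<K. c N k * x ^ k) \<le> s N" for N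
      using sum_le_suminf[OF sums_summable[OF sums], of "{..<K}" N] nonneg \<open>x \<ge> 0\<close> sums_unique[OF sums]
      by simp
    thus "\<exists>M. \<forall>N\<ge>M. (\<Sum>k<K. c N k * x ^ k) \<le> s N" by blast
  qed
  have summ: "summable (\<lambda>k. q k * x ^ k)"
    by (rule summableI_nonneg_bounded[OF q bound])
  have "(\<Sum>k. q k * x ^ k) = P"
  proof (rule antisym)
    show "(\<Sum>k. q k * x ^ k) \<le> P" by (rule suminf_le_const[OF summ bound])
    have "s N \<le> (\<Sum>k. q k * x ^ k)" for N
      by (rule sums_le[OF _ sums summable_sums[OF summ]])
        (use le \<open>x \<ge> 0\<close> in \<open>auto intro!: mult_right_mono\<close>)
    thus "P \<le> (\<Sum>k. q k * x ^ k)" by (intro LIMSEQ_le_const2[OF s]) blast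
  qed
  thus ?thesis using summ by (simp add: sums_iff)
qed

section \<open>Formal power series with nonnegative coefficients\<close>

text \<open>This class is closed under products, and the constant term 1 ensures that multiplying by
  a member never lowers a coefficient.\<close>

definition nonneg_unital :: "real fps \<Rightarrow> bool" where
  "nonneg_unital f \<longleftrightarrow> fps_nth f 0 = 1 \<and> (\<forall>k. 0 \<le> fps_nth f k)"

lemma nonneg_unital_1: "nonneg_unital 1"
  by (simp add: nonneg_unital_def)

lemma nonneg_unital_mult: "nonneg_unital f \<Longrightarrow> nonneg_unital g \<Longrightarrow> nonneg_unital (f * g)"
  by (auto simp: nonneg_unital_def fps_mult_nth intro!: sum_nonneg)

lemma nonneg_unital_power: "nonneg_unital f \<Longrightarrow> nonneg_unital (f ^ n)"
  by (induction n) (auto intro: nonneg_unital_1 nonneg_unital_mult)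

lemma nonneg_unital_prod: "(\<And>i. i \<in> S \<Longrightarrow> nonneg_unital (f i)) \<Longrightarrow> nonneg_unital (\<Prod>i\<in>S. f i)"
  by (induction S rule: infinite_finite_induct) (auto intro: nonneg_unital_1 nonneg_unital_mult)

text \<open>In the Cauchy product the term with index \<open>k\<close> is the \<open>k\<close>-th
  coefficient of \<open>f\<close> times the constant term 1 of \<open>g\<close>; the other terms are
  nonnegative.\<close>

lemma nth_le_nth_mult:
  assumes "nonneg_unital f" "nonneg_unital g"
  shows "fps_nth f k \<le> fps_nth (f * g) k"
proof -
  have "fps_nth f k * fps_nth g (k - k) \<le> (\<Sum>i=0..k. fps_nth f i * fps_nth g (k - i))"
    by (rule member_le_sum) (use assms in \<open>auto simp: nonneg_unital_def\<close>)
  thus ?thesis using assms by (simp add: fps_mult_nth nonneg_unital_def)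
qed

text \<open>Nonnegativity is bundled with summation because it makes convergence at
  \<open>x \<ge> 0\<close> absolute, as the Cauchy product theorem requires.\<close>

definition nonneg_unital_sums :: "real fps \<Rightarrow> real \<Rightarrow> real \<Rightarrow> bool" where
  "nonneg_unital_sums f x y \<longleftrightarrow> nonneg_unital f \<and> (\<lambda>k. fps_nth f k * x ^ k) sums y"

lemma nonneg_unital_sums_1: "nonneg_unital_sums 1 x 1"
proof -
  have "(\<lambda>k. fps_nth 1 k * x ^ k) = (\<lambda>k. if k = 0 then 1 else 0)"
    by (auto simp: fun_eq_iff)
  thus ?thesis
    using sums_single[of 0 "\<lambda>_. 1 :: real"] by (simp add: nonneg_unital_sums_def nonneg_unital_1)
qed

lemma nonneg_unital_sums_mult:
  assumes "x \<ge> 0" "nonneg_unital_sums f x y" "nonneg_unital_sums g x z"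
  shows "nonneg_unital_sums (f * g) x (y * z)"
proof -
  have "summable (\<lambda>k. norm (fps_nth h k * x ^ k))" if "nonneg_unital_sums h x w" for h w
    using that \<open>x \<ge> 0\<close> by (auto simp: nonneg_unital_sums_def nonneg_unital_def sums_iff abs_mult)
  from Cauchy_product_sums[OF this[OF assms(2)] this[OF assms(3)]]
  have "(\<lambda>k. \<Sum>i\<le>k. fps_nth f i * x ^ i * (fps_nth g (k - i) * x ^ (k - i))) sums (y * z)"
    using assms by (simp add: nonneg_unital_sums_def sums_iff)
  also have "(\<lambda>k. \<Sum>i\<le>k. fps_nth f i * x ^ i * (fps_nth g (k - i) * x ^ (k - i))) =
      (\<lambda>k. fps_nth (f * g) k * x ^ k)"
  proof
    fix k
    show "(\<Sum>i\<le>k. fps_nth f i * x ^ i * (fps_nth g (k - i) * x ^ (k - i))) =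
        fps_nth (f * g) k * x ^ k"
      unfolding fps_mult_nth sum_distrib_right atLeast0AtMost
    proof (rule sum.cong[OF refl])
      fix i assume "i \<in> {..k}"
      thus "fps_nth f i * x ^ i * (fps_nth g (k - i) * x ^ (k - i)) =
          fps_nth f i * fps_nth g (k - i) * x ^ k"
        using power_add[of x i "k - i"] by simp
    qed
  qed
  finally show ?thesis
    using assms by (simp add: nonneg_unital_sums_def nonneg_unital_mult)
qed

lemma nonneg_unital_sums_power:
  "x \<ge> 0 \<Longrightarrow> nonneg_unital_sums f x y \<Longrightarrow> nonneg_unital_sums (f ^ n) x (y ^ n)"
  by (induction n) (auto intro: nonneg_unital_sums_1 nonneg_unital_sums_mult)

lemma nonneg_unital_sums_prod:
  "x \<ge> 0 \<Longrightarrow> (\<And>i. i \<in> S \<Longrightarrow> nonneg_unital_sums (f i) x (y i)) \<Longrightarrow>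
    nonneg_unital_sums (\<Prod>i\<in>S. f i) x (\<Prod>i\<in>S. y i)"
  by (induction S rule: infinite_finite_induct)
    (auto intro: nonneg_unital_sums_1 nonneg_unital_sums_mult)

text \<open>The expansion of \<open>1 / (1 - X^m)\<close> for positive \<open>m\<close>; for
  \<open>m = 0\<close> it is the constant 1, since 0 divides only 0.\<close>

definition geometric_fps :: "nat \<Rightarrow> real fps" where
  "geometric_fps m = Abs_fps (\<lambda>k. if m dvd k then 1 else 0)"

lemma nonneg_unital_sums_geometric_fps:
  assumes "m > 0" "0 \<le> x" "x < 1"
  shows "nonneg_unital_sums (geometric_fps m) x (inverse (1 - x ^ m))"
proof -
  let ?f = "\<lambda>k. fps_nth (geometric_fps m) k * x ^ k"
  have "x ^ m < 1" using assms by (simp add: power_less_one_iff)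
  hence "(\<lambda>k. (x ^ m) ^ k) sums (1 / (1 - x ^ m))"
    using assms by (intro geometric_sums) auto
  hence "(\<lambda>k. ?f (m * k)) sums inverse (1 - x ^ m)"
    by (simp add: geometric_fps_def power_mult inverse_eq_divide)
  also have "?this \<longleftrightarrow> ?f sums inverse (1 - x ^ m)"
    using assms by (intro sums_mono_reindex) (auto simp: strict_mono_def geometric_fps_def)
  finally show ?thesis
    by (simp add: nonneg_unital_sums_def nonneg_unital_def geometric_fps_def)
qed

lemma nonneg_unital_geometric_fps: "nonneg_unital (geometric_fps m)"
  by (simp add: nonneg_unital_def geometric_fps_def)

section \<open>The infinite product\<close>

definition cancelled :: "nat \<Rightarrow> nat set \<Rightarrow> nat \<Rightarrow> nat set" where
  "cancelled b I N = (\<lambda>(n, i). b * (n + 1) - i) ` ({..<N} \<times> I)"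

text \<open>As \<open>i < b\<close>, the exponent lies in the block from \<open>b * n + 1\<close> to
  \<open>b * (n + 1)\<close>, so it determines first \<open>n\<close> and then
  \<open>i\<close>.\<close>

lemma inj_on_cancelled:
  fixes b :: nat
  assumes "I \<subseteq> {..<b - 1}"
  shows "inj_on (\<lambda>(n, i). b * (n + 1) - i) (UNIV \<times> I)"
proof (rule inj_onI, clarify)
  fix n n' i i'
  assume "i \<in> I" "i' \<in> I" and eq: "b * (n + 1) - i = b * (n' + 1) - i'"
  have "i < b - 1" "i' < b - 1" using \<open>i \<in> I\<close> \<open>i' \<in> I\<close> assms by blast+
  hence "i < b" "i' < b" by linarith+
  \<comment> \<open>Subtracting 1 before dividing puts the top of the block, reached for
    \<open>j = 0\<close>, into the same residue range as the rest.\<close>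
  have *: "(b * (k + 1) - j - 1) div b = k" if "j < b" for k j
    using that by (intro div_nat_eqI) (auto simp: algebra_simps)
  have "n = n'" using *[OF \<open>i < b\<close>, of n] *[OF \<open>i' < b\<close>, of n'] unfolding eq by simp
  moreover from this have "i = i'"
    using eq \<open>i < b\<close> \<open>i' < b\<close> by (simp add: algebra_simps)
  ultimately show "n = n' \<and> i = i'" by simp
qed

text \<open>The lower bound 2 is where the exclusion of \<open>b - 1\<close> from \<open>I\<close>
  enters: it keeps the exponent 1 from being cancelled.\<close>

lemma cancelled_subset:
  assumes "I \<subseteq> {..<b - 1}"
  shows "cancelled b I N \<subseteq> {2..b * N}"
proof
  fix m assume "m \<in> cancelled b I N"
  then obtain n i where ni: "n < N" "i \<in> I" "m = b * (n + 1) - i"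
    by (auto simp: cancelled_def)
  have "b * (n + 1) \<le> b * N" using ni by (intro mult_le_mono2) auto
  moreover have "i < b - 1" using ni assms by auto
  ultimately show "m \<in> {2..b * N}" using ni by auto
qed

lemma prod_cancelled:
  assumes "I \<subseteq> {..<b - 1}"
  shows "(\<Prod>m\<in>cancelled b I N. f m) = (\<Prod>n<N. \<Prod>i\<in>I. f (b * (n + 1) - i))"
proof -
  have "inj_on (\<lambda>(n, i). b * (n + 1) - i) ({..<N} \<times> I)"
    by (rule inj_on_subset[OF inj_on_cancelled[OF assms]]) auto
  thus ?thesis
    unfolding cancelled_def by (subst prod.reindex) (auto simp: prod.cartesian_product case_prod_unfold)
qed

text \<open>The cutoff is \<open>b * N\<close>, not \<open>N\<close>, so that the numerator
  exponents with \<open>n < N\<close> all find a denominator factor to cancel.\<close>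

definition surviving :: "nat \<Rightarrow> nat set \<Rightarrow> nat \<Rightarrow> nat set" where
  "surviving b I N = {1..b * N} - cancelled b I N"

text \<open>A numerator factor with \<open>n \<ge> N\<close> has exponent above
  \<open>b * N\<close>, so enlarging the cutoff never cancels an exponent that survived
  before.\<close>

lemma surviving_mono:
  assumes "I \<subseteq> {..<b - 1}" "N \<le> N'"
  shows "surviving b I N \<subseteq> surviving b I N'"
proof
  fix m assume m: "m \<in> surviving b I N"
  have "m \<notin> cancelled b I N'"
  proof
    assume "m \<in> cancelled b I N'"
    then obtain n i where ni: "n < N'" "i \<in> I" "m = b * (n + 1) - i"
      by (auto simp: cancelled_def)
    hence "\<not> n < N" using m by (auto simp: surviving_def cancelled_def)
    hence "b * N \<le> b * n" by (intro mult_le_mono2) auto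
    moreover have "i < b" using ni assms by auto
    moreover from this have "m = b * n + (b - i)" using ni by simp
    ultimately have "b * N < m" by linarith
    thus False using m by (simp add: surviving_def)
  qed
  moreover have "m \<le> b * N'"
    using m mult_le_mono2[OF \<open>N \<le> N'\<close>, of b] unfolding surviving_def
    by (metis DiffD1 atLeastAtMost_iff le_trans)
  moreover have "1 \<le> m" using m by (simp add: surviving_def)
  ultimately show "m \<in> surviving b I N'" by (simp add: surviving_def)
qed

section \<open>The finite products as formal power series\<close>

definition surviving_fps :: "nat \<Rightarrow> nat \<Rightarrow> nat set \<Rightarrow> nat \<Rightarrow> real fps" where
  "surviving_fps a b I N = (\<Prod>m\<in>surviving b I N. geometric_fps m ^ a)"

lemma nonneg_unital_surviving_fps: "nonneg_unital (surviving_fps a b I N)"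
  unfolding surviving_fps_def
  by (intro nonneg_unital_prod nonneg_unital_power nonneg_unital_geometric_fps)

lemma incseq_surviving_fps:
  assumes "I \<subseteq> {..<b - 1}"
  shows "incseq (\<lambda>N. fps_nth (surviving_fps a b I N) k)"
proof (rule monoI)
  fix N N' :: nat assume "N \<le> N'"
  have "surviving_fps a b I N' = surviving_fps a b I N *
      (\<Prod>m\<in>surviving b I N' - surviving b I N. geometric_fps m ^ a)"
    unfolding surviving_fps_def
    using prod.subset_diff[OF surviving_mono[OF assms \<open>N \<le> N'\<close>], of "\<lambda>m. geometric_fps m ^ a"]
    by (simp add: surviving_def mult.commute)
  also have "fps_nth (surviving_fps a b I N) k \<le> fps_nth \<dots> k"
    by (intro nth_le_nth_mult nonneg_unital_surviving_fps nonneg_unital_prod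
        nonneg_unital_power nonneg_unital_geometric_fps)
  finally show "fps_nth (surviving_fps a b I N) k \<le> fps_nth (surviving_fps a b I N') k" .
qed

text \<open>The exponent 1 survives and \<open>a \<ge> 1\<close>, so one copy of
  \<open>1 / (1 - X)\<close>, with all coefficients 1, splits off; the cofactor cannot lower
  them.\<close>

lemma surviving_fps_ge_1:
  assumes "a \<ge> 1" "b \<ge> 1" "I \<subseteq> {..<b - 1}" "N \<ge> 1"
  shows "fps_nth (surviving_fps a b I N) k \<ge> 1"
proof -
  have "1 \<in> surviving b I N"
    using assms cancelled_subset[OF assms(3), of N] by (auto simp: surviving_def Suc_le_eq)
  hence "surviving_fps a b I N =
      geometric_fps 1 ^ a * (\<Prod>m\<in>surviving b I N - {1}. geometric_fps m ^ a)"
    unfolding surviving_fps_def by (intro prod.remove) (auto simp: surviving_def)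
  also have "geometric_fps 1 ^ a = geometric_fps 1 * geometric_fps 1 ^ (a - 1)"
    using \<open>a \<ge> 1\<close> by (metis Suc_diff_1 Suc_le_eq power_Suc One_nat_def)
  finally have "fps_nth (geometric_fps 1) k \<le> fps_nth (surviving_fps a b I N) k"
    by (auto simp: mult.assoc intro!: nth_le_nth_mult nonneg_unital_mult nonneg_unital_prod
        nonneg_unital_power nonneg_unital_geometric_fps)
  thus ?thesis by (simp add: geometric_fps_def)
qed

section \<open>Convergence of the infinite product on \<open>[0, 1)\<close>\<close>

lemma convergent_prod_one_minus_power:
  fixes x :: real
  assumes "0 \<le> x" "x < 1" "strict_mono g" "g 0 > 0"
  shows "convergent_prod (\<lambda>n. 1 - x ^ g n)"
proof -
  have "summable (\<lambda>n. x ^ n)" using assms by (intro summable_geometric) auto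
  \<comment> \<open>Strict monotonicity gives \<open>n \<le> g n\<close>, so a geometric series
    dominates.\<close>
  moreover have "\<bar>- (x ^ g n)\<bar> \<le> x ^ n" for n
    using assms strict_mono_imp_increasing[of g n] by (auto intro: power_decreasing)
  ultimately have "summable (\<lambda>n. \<bar>- (x ^ g n)\<bar>)"
    using summable_comparison_test'[of "\<lambda>n. x ^ n" 0 "\<lambda>n. \<bar>- (x ^ g n)\<bar>"] by simp
  moreover have "- (x ^ g n) \<noteq> -1" for n
  proof -
    have "g n > 0" using assms(3,4) strict_mono_less_eq[of g 0 n] by simp
    hence "x ^ g n < 1" using assms by (simp add: power_less_one_iff)
    thus ?thesis by simp
  qed
  ultimately show ?thesis using summable_imp_convergent_prod_real[of "\<lambda>n. - (x ^ g n)"] by simp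
qed

text \<open>Polymorphic, because the limit argument runs over the reals while the theorem concerns
  complex \<open>x\<close>.\<close>

definition factor :: "nat \<Rightarrow> nat \<Rightarrow> nat set \<Rightarrow> 'a::field \<Rightarrow> nat \<Rightarrow> 'a" where
  "factor a b I x n =
    (1 - x ^ (n + 1)) powi (- int a) * (\<Prod>i\<in>I. (1 - x ^ (b * (n + 1) - i)) ^ a)"

lemma convergent_prod_factor:
  fixes x :: real
  assumes "I \<subseteq> {..<b - 1}" "0 \<le> x" "x < 1"
  shows "convergent_prod (factor a b I x)"
proof -
  have "strict_mono (\<lambda>n. b * (n + 1) - i)" "b * (0 + 1) - i > 0" if "i \<in> I" for i
  proof -
    have "i < b" using that assms by auto
    thus "b * (0 + 1) - i > 0" by simp
    show "strict_mono (\<lambda>n. b * (n + 1) - i)"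
      unfolding strict_mono_Suc_iff using \<open>i < b\<close> by (auto simp: algebra_simps)
  qed
  hence "convergent_prod (\<lambda>n. 1 - x ^ (b * (n + 1) - i))" if "i \<in> I" for i
    using that assms by (intro convergent_prod_one_minus_power) auto
  moreover have "convergent_prod (\<lambda>n. 1 - x ^ (n + 1))"
    using assms by (intro convergent_prod_one_minus_power) (auto simp: strict_mono_def)
  ultimately show ?thesis
    unfolding factor_def power_int_minus power_int_of_nat
    by (intro convergent_prod_mult convergent_prod_prod convergent_prod_power
        convergent_prod_inverse)
qed

text \<open>The partial product of \<open>factor\<close> has denominator exponents only up to
  \<open>N\<close>. Multiplying by \<open>(E N / E (b * N)) ^ a\<close> extends them to
  \<open>b * N\<close>, and this correction tends to 1.\<close>

lemma prod_surviving_tendsto: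
  fixes x :: real
  assumes "b \<ge> 1" "I \<subseteq> {..<b - 1}" "0 \<le> x" "x < 1"
  shows "(\<lambda>N. \<Prod>m\<in>surviving b I N. inverse (1 - x ^ m) ^ a) \<longlonglongrightarrow> prodinf (factor a b I x)"
proof -
  define E where "E N = (\<Prod>n<N. 1 - x ^ (n + 1))" for N
  have nz: "x ^ m \<noteq> 1" if "m > 0" for m
    using power_less_one_iff[of x m] that assms by auto
  have conv: "convergent_prod (\<lambda>n. 1 - x ^ (n + 1))"
    using assms by (intro convergent_prod_one_minus_power) (auto simp: strict_mono_def)
  define e where "e = (\<Prod>n. 1 - x ^ (n + 1))"
  have E: "E \<longlonglongrightarrow> e"
    unfolding E_def e_def
    using has_prod_imp_tendsto'[OF convergent_prod_has_prod[OF conv]] .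
  \<comment> \<open>A nonzero limit is what makes the quotient of \<open>E N\<close> and
    \<open>E (b * N)\<close> tend to 1.\<close>
  have "e \<noteq> 0" unfolding e_def using conv nz by (intro prodinf_nonzero) (simp_all del: power_Suc)
  have "strict_mono (\<lambda>N. b * N)" using \<open>b \<ge> 1\<close> by (auto simp: strict_mono_def)
  from LIMSEQ_subseq_LIMSEQ[OF E this] have Eb: "(\<lambda>N. E (b * N)) \<longlonglongrightarrow> e"
    by (simp add: o_def)
  have "(\<lambda>N. \<Prod>n<N. factor a b I x n) \<longlonglongrightarrow> prodinf (factor a b I x)"
    using has_prod_imp_tendsto'[OF convergent_prod_has_prod[OF convergent_prod_factor]] assms by blast
  hence "(\<lambda>N. (E N / E (b * N)) ^ a * (\<Prod>n<N. factor a b I x n)) \<longlonglongrightarrow>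
      (e / e) ^ a * prodinf (factor a b I x)"
    by (intro tendsto_mult tendsto_power tendsto_divide E Eb \<open>e \<noteq> 0\<close>)
  also have "(\<lambda>N. (E N / E (b * N)) ^ a * (\<Prod>n<N. factor a b I x n)) =
      (\<lambda>N. \<Prod>m\<in>surviving b I N. inverse (1 - x ^ m) ^ a)"
  proof
    fix N
    define C where "C = (\<Prod>m\<in>cancelled b I N. 1 - x ^ m)"
    define S where "S = (\<Prod>m\<in>surviving b I N. 1 - x ^ m)"
    have sub: "cancelled b I N \<subseteq> {1..b * N}" using cancelled_subset[OF assms(2), of N] by auto
    have E_alt: "E M = (\<Prod>m\<in>{1..M}. 1 - x ^ m)" for M
      unfolding E_def by (rule prod.reindex_bij_witness[of _ "\<lambda>m. m - 1" Suc]) auto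
    have "E (b * N) = S * C"
      unfolding E_alt S_def C_def surviving_def by (rule prod.subset_diff[OF sub]) auto
    moreover have "E N \<noteq> 0" unfolding E_alt by (simp add: nz)
    moreover have "C \<noteq> 0" "S \<noteq> 0"
      using sub nz by (auto simp: C_def S_def surviving_def prod_zero_iff finite_subset)
    moreover have "(\<Prod>n<N. factor a b I x n) = inverse (E N ^ a) * C ^ a"
      unfolding factor_def E_def C_def prod_cancelled[OF assms(2)]
      by (simp add: prod.distrib power_int_minus_divide prod_dividef inverse_eq_divide
          flip: prod_power_distrib)
    moreover have "(\<Prod>m\<in>surviving b I N. inverse (1 - x ^ m) ^ a) = inverse (S ^ a)"
      unfolding S_def by (simp add: prod_dividef inverse_eq_divide power_divide flip: prod_power_distrib)
    ultimately show "(E N / E (b * N)) ^ a * (\<Prod>n<N. factor a b I x n) =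
        (\<Prod>m\<in>surviving b I N. inverse (1 - x ^ m) ^ a)"
      by (simp add: power_divide power_mult_distrib field_simps)
  qed
  finally show ?thesis using \<open>e \<noteq> 0\<close> by simp
qed

text \<open>The sequence \<open>q\<close> consists of the limits of the coefficients of the finite
  products, so a single \<open>q\<close> serves every \<open>x\<close>.\<close>

lemma prodinf_factor_powser:
  assumes "a \<ge> 1" "b \<ge> 1" "I \<subseteq> {..<b - 1}"
  obtains q :: "nat \<Rightarrow> real" where "\<And>k. q k \<ge> 1"
    "\<And>x. 0 < x \<Longrightarrow> x < 1 \<Longrightarrow> (\<lambda>k. q k * x ^ k) sums prodinf (factor a b I x)"
proof -
  define c where "c N k = fps_nth (surviving_fps a b I N) k" for N k
  define s where "s x N = (\<Prod>m\<in>surviving b I N. inverse (1 - x ^ m) ^ a)" for x :: real and N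
  have nonneg: "0 \<le> c N k" for N k
    using nonneg_unital_surviving_fps by (simp add: c_def nonneg_unital_def)
  have mono: "incseq (\<lambda>N. c N k)" for k
    unfolding c_def by (rule incseq_surviving_fps[OF assms(3)])
  have lim_s: "s x \<longlonglongrightarrow> prodinf (factor a b I x)" if "0 < x" "x < 1" for x
    unfolding s_def using prod_surviving_tendsto assms that by simp
  have sums: "(\<lambda>k. c N k * x ^ k) sums s x N" if "0 < x" "x < 1" for x N
  proof -
    have "nonneg_unital_sums (surviving_fps a b I N) x (s x N)"
      unfolding surviving_fps_def s_def using that
      by (intro nonneg_unital_sums_prod nonneg_unital_sums_power nonneg_unital_sums_geometric_fps)
        (auto simp: surviving_def)
    thus ?thesis by (simp add: nonneg_unital_sums_def c_def)
  qed
  have "\<exists>l. (\<lambda>N. c N k) \<longlonglongrightarrow> l" for k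
  proof -
    \<comment> \<open>Convergence at the single point 1/2 bounds every coefficient: one term of a
      nonnegative series is at most its sum, hence at most \<open>B\<close>.\<close>
    obtain B where B: "s (1/2) N \<le> B" for N
      using convergent_imp_Bseq[OF convergentI[OF lim_s[of "1/2"]]]
      by (auto simp: Bseq_def abs_le_iff)
    have "c N k \<le> B * 2 ^ k" for N
    proof -
      have "(\<Sum>j\<in>{k}. c N j * (1/2) ^ j) \<le> (\<Sum>j. c N j * (1/2) ^ j)"
        using nonneg by (intro sum_le_suminf sums_summable[OF sums]) auto
      also have "\<dots> = s (1/2) N" using sums[of "1/2" N] by (simp add: sums_iff)
      also have "\<dots> \<le> B" by (rule B)
      finally show ?thesis by (simp add: field_simps)
    qed
    then obtain l where "(\<lambda>N. c N k) \<longlonglongrightarrow> l" using incseq_convergent[OF mono] by blast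
    thus ?thesis by blast
  qed
  then obtain q where q: "\<And>k. (\<lambda>N. c N k) \<longlonglongrightarrow> q k" by metis
  show ?thesis
  proof
    show "q k \<ge> 1" for k
      \<comment> \<open>For \<open>N = 0\<close> the product is empty; from \<open>N = 1\<close> on
        it contains the factor with exponent 1.\<close>
      using surviving_fps_ge_1[OF assms, of 1 k] incseq_le[OF mono q, of 1 k] by (simp add: c_def)
    show "(\<lambda>k. q k * x ^ k) sums prodinf (factor a b I x)" if "0 < x" "x < 1" for x
      using that by (intro monotone_convergence_powser[OF nonneg _ mono q sums lim_s]) auto
  qed
qed

theorem theorem5p1:
  fixes a b :: nat and I :: "nat set" and A :: "nat \<Rightarrow> complex"
  assumes "a \<ge> 1" and "b \<ge> 1"
    and "I \<noteq> {}" and "I \<subseteq> {..<b - 1}"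
    and "\<And>x :: complex. norm x < 1 \<Longrightarrow>
           (\<lambda>n. A n * x ^ n) sums
           (\<Prod>n. (1 - x ^ (n + 1)) powi (- int a) * (\<Prod>i\<in>I. (1 - x ^ (b * (n + 1) - i)) ^ a))"
  shows "\<forall>n. A n \<in> \<real> \<and> 0 < Re (A n)"
proof -
  obtain q :: "nat \<Rightarrow> real" where q1: "\<And>k. q k \<ge> 1" and
    q: "\<And>x. 0 < x \<Longrightarrow> x < 1 \<Longrightarrow> (\<lambda>k. q k * x ^ k) sums prodinf (factor a b I x)"
    using prodinf_factor_powser[OF assms(1,2,4)] by metis
  have A: "(\<lambda>n. A n * x ^ n) sums prodinf (factor a b I x)" if "norm x < 1" for x
    using assms(5)[OF that] by (simp only: factor_def[abs_def])
  have "A = (\<lambda>n. of_real (q n))"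
  proof (rule powser_coeffs_unique_pos_real[of "1/2"])
    show "summable (\<lambda>n. A n * z ^ n)" if "norm z < 1/2" for z
      using A[of z] that by (auto simp: sums_iff)
    show "summable (\<lambda>n. of_real (q n) * z ^ n)" if "norm z < 1/2" for z :: complex
      \<comment> \<open>Convergence at the real point 1/2 carries over to the open complex disc of
        that radius.\<close>
      by (rule powser_inside[of _ "of_real (1/2)"])
        (use that sums_summable[OF q[of "1/2"]] in
          \<open>auto dest: summable_of_real[where ?'a = complex]\<close>)
    fix x :: real assume x: "0 < x" "x < 1/2"
    have "factor a b I (of_real x :: complex) = (\<lambda>n. of_real (factor a b I x n))"
      by (simp add: factor_def fun_eq_iff)
    \<comment> \<open>The complex product is identified with the real one through
      \<open>has_prod\<close>, using convergence of the real product.\<close>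
    moreover have "(\<lambda>n. complex_of_real (factor a b I x n)) has_prod of_real (prodinf (factor a b I x))"
      using convergent_prod_has_prod[OF convergent_prod_factor[OF assms(4)]] x by simp
    ultimately have "prodinf (factor a b I (of_real x :: complex)) = of_real (prodinf (factor a b I x))"
      using has_prod_unique by metis
    moreover have "(\<lambda>n. complex_of_real (q n) * of_real x ^ n) sums of_real (prodinf (factor a b I x))"
      using sums_of_real[OF q[of x], where ?'a = complex] x by simp
    ultimately show "(\<Sum>n. A n * of_real x ^ n) = (\<Sum>n. of_real (q n) * of_real x ^ n)"
      using A[of "of_real x"] x by (simp add: sums_iff)
  qed simp
  moreover have "q n > 0" for n using q1[of n] by simp
  ultimately show ?thesis by simp
qed

end
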